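(* Let $(\Omega,\mathcal{F},P)$ be a probability space and $\{A_n\}_{n\ge 1}$ a sequence of events. Put $S_n=\sum_{k=1}^n \mathbb{I}(A_k)$ and $E_n=\sum_{k=1}^n P(A_k)$, and assume that $E_n\to\infty$ as $n\to\infty$. Let $\psi(x)$, $x\ge 0$, be a non-decreasing positive function with $\sum_{n=1}^\infty \frac{1}{n\psi(n)}<\infty$. Let $c(x)$, $x\ge 0$, be a positive non-increasing continuous function such that $c(x)\to 0$ as $x\to\infty$ and $f(x)=x/c(x)$ is increasing, and put $c_n=c(n)$ for all natural $n$. Let $\{b_n\}_{n\ge 1}$ be a sequence of real numbers such that $\sum_{n=1}^\infty b_n<\infty$. (1) Assume that $$P(A_iA_j)\le (1+c_{j-i})P(A_i)P(A_j)+b_{j-i}P(A_i)\quad\text{for all } i<j.$$ Then $$S_n=E_n+o\left(\sqrt{g(E_n)\,\psi(\log E_n)}\,(\log E_n)^{3/2}\right)\quad\text{almost surely as } n\to\infty$$ with $g(x)=x f^{-1}(x)$, where $f^{-1}$ is the inverse function of $f$. (2) If the inequalities hold with $0$ in place of $c_{j-i}$, i.e. $$P(A_iA_j)\le P(A_i)P(A_j)+b_{j-i}P(A_i)\quad\text{for all } i<j,$$ then $$S_n=E_n+o\left(\sqrt{g(E_n)\,\psi(\log E_n)}\,(\log E_n)^{3/2}\right)\quad\text{almost surely as } n\to\infty$$ with $g(x)=x$.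
   Context: $\mathbb{I}(A)$ denotes the indicator of the event $A$, and $A_iA_j=A_i\cap A_j$. The relation $S_n=E_n+o(h_n)$ almost surely means that $(S_n-E_n)/h_n\to 0$ as $n\to\infty$ with probability one. *)

theory Defs
  imports "HOL-Probability.Probability"
begin

definition event_count :: "(nat \<Rightarrow> 'a set) \<Rightarrow> nat \<Rightarrow> 'a \<Rightarrow> real" where
  "event_count A n \<omega> = (\<Sum>k=1..n. indicator (A k) \<omega>)"

definition event_mean :: "'a measure \<Rightarrow> (nat \<Rightarrow> 'a set) \<Rightarrow> nat \<Rightarrow> real" where
  "event_mean M A n = (\<Sum>k=1..n. measure M (A k))"

text \<open>
  \<open>as_eq_little_o M S E h\<close> renders \<open>S n = E n + o(h n)\<close> almost surely. Only the tail of \<open>h\<close>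
  matters, so zeros of \<open>h\<close> at finitely many indices are harmless.
\<close>

definition as_eq_little_o ::
    "'a measure \<Rightarrow> (nat \<Rightarrow> 'a \<Rightarrow> real) \<Rightarrow> (nat \<Rightarrow> real) \<Rightarrow> (nat \<Rightarrow> real) \<Rightarrow> bool" where
  "as_eq_little_o M S E h \<longleftrightarrow> (AE \<omega> in M. (\<lambda>n. (S n \<omega> - E n) / h n) \<longlonglongrightarrow> 0)"

text \<open>
  The normalisation is meant for \<open>x > 1\<close>, where \<open>ln x > 0\<close>; it is used along \<open>x = E n\<close> with
  \<open>E n\<close> tending to infinity.
\<close>

definition error_rate :: "(real \<Rightarrow> real) \<Rightarrow> (real \<Rightarrow> real) \<Rightarrow> real \<Rightarrow> real" where
  "error_rate g \<psi> x = sqrt (g x * \<psi> (ln x)) * ln x powr (3/2)"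

end

theory Submission
  imports Defs
begin

text \<open>
  Write \<open>E\<close> for the mean, \<open>S\<close> for the count, and \<open>T = S - E\<close>. Both hypotheses bound how much
  a later event can be positively correlated with an earlier one, and they yield a variance bound
  \<open>Var (S n - S m) \<le> K y F(y)\<close> for every \<open>y \<ge> max 1 (E n - E m)\<close>, with \<open>F\<close> the inverse of \<open>f\<close>
  under the first hypothesis and \<open>F = 1\<close> under the second. For the first one, the sum over \<open>j > i\<close>
  of \<open>c (j - i) P(A j)\<close> is cut at distance \<open>z\<close>: near terms give at most \<open>c 0 * z\<close>, far terms at
  most \<open>c z * y\<close>. The cut \<open>z = F(y)\<close> is the one that balances the two, since \<open>f z = y\<close> says
  precisely \<open>z = y * c z\<close>. The terms with \<open>b\<close> only contribute their bounded partial sums.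

  The rest uses nothing but this variance bound. Time is reparametrised so that the mean grows at
  unit speed: the process is observed at the first indices at which \<open>E\<close> reaches \<open>0, 1, 2, ...\<close>, and
  monotonicity of \<open>S\<close> and \<open>E\<close> shows that in between \<open>T\<close> moves by a bounded amount only
  (\<open>deviation_sandwich\<close>). On the new scale the variance of an increment over a stretch of length
  \<open>d\<close> within the first \<open>4^(r+1)\<close> points is at most a multiple of \<open>F(4^r) * d\<close>, because
  \<open>F(a x) \<le> a F(x)\<close>. The Rademacher--Menshov argument (\<open>dyadic_chaining\<close> together with
  \<open>expectation_dyadic_energy_le\<close>) then bounds the mean of the maximum of \<open>T\<^sup>2\<close> over these points by a
  multiple of \<open>r\<^sup>2 * 4^r * F(4^r)\<close>.

  For \<open>4^r \<le> E n < 4^(r+1)\<close> the square of the claimed error is at least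
  \<open>4^r * F(4^r) * \<psi>(r) * r\<^sup>3\<close>. The ratios of the mean maxima to these numbers are at most a multiple
  of \<open>1 / (r * \<psi>(r))\<close>, which is summable; hence almost surely the ratios of the maxima themselves
  tend to zero.
\<close>

section \<open>The Rademacher--Menshov inequality\<close>

text \<open>
  The sum of squared increments of \<open>t\<close> over all dyadic intervals inside \<open>[0, 2^R]\<close>. It stands in for
  the maximum of \<open>(t k - t 0)\<^sup>2\<close>, having an expectation that can be computed increment by increment.
\<close>

definition dyadic_energy :: "(nat \<Rightarrow> real) \<Rightarrow> nat \<Rightarrow> real" where
  "dyadic_energy t R = (\<Sum>s\<le>R. \<Sum>j<2^(R-s). (t ((j+1) * 2^s) - t (j * 2^s))\<^sup>2)"

lemma dyadic_energy_nonneg: "0 \<le> dyadic_energy t R"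
  unfolding dyadic_energy_def by (intro sum_nonneg) auto

text \<open>
  Rounding \<open>k\<close> down to multiples of \<open>2^0, 2^1, ..., 2^(R+1)\<close> leads from \<open>k\<close> to \<open>0\<close>. Each step is
  either trivial or crosses one dyadic interval of its level, so \<open>R + 1\<close> dyadic increments connect
  \<open>0\<close> to \<open>k\<close>, and Cauchy--Schwarz turns their sum into a sum of squares. This is the pointwise half
  of the Rademacher--Menshov inequality.
\<close>

lemma dyadic_chaining:
  assumes "k \<le> 2^R"
  shows "(t k - t 0)\<^sup>2 \<le> real (R+1) * dyadic_energy t R"
proof -
  define trunc where "trunc s = (k div 2^s) * 2^s" for s
  have top: "trunc (Suc R) = 0"
  proof -
    have "k < 2^Suc R"
      using assms by (rule le_less_trans) simp
    then show ?thesis by (simp add: trunc_def)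
  qed
  have "t k - t 0 = (\<Sum>s\<le>R. t (trunc s) - t (trunc (Suc s)))"
    using sum_telescope[of "\<lambda>s. t (trunc s)" R] top by (simp add: trunc_def)
  also have "\<dots>\<^sup>2 \<le> (\<Sum>s\<le>R. (t (trunc s) - t (trunc (Suc s)))\<^sup>2) * (\<Sum>s\<le>R. 1\<^sup>2)"
    using Cauchy_Schwarz_ineq_sum[of "\<lambda>s. t (trunc s) - t (trunc (Suc s))" "\<lambda>_. 1" "{..R}"]
    by simp
  also have "\<dots> \<le> dyadic_energy t R * (\<Sum>s\<le>R. 1\<^sup>2)"
    unfolding dyadic_energy_def
  proof (intro mult_right_mono sum_mono)
    fix s assume "s \<in> {..R}"
    then have sR: "s \<le> R" by simp
    define q where "q = k div 2^s"
    have q_le: "q \<le> 2^(R-s)"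
    proof -
      have "q \<le> 2^R div 2^s" unfolding q_def using assms by (rule div_le_mono)
      also have "\<dots> = 2^(R-s)" using sR by (simp add: power_diff)
      finally show ?thesis .
    qed
    have lo: "trunc s = q * 2^s" by (simp add: trunc_def q_def)
    have hi: "trunc (Suc s) = (q div 2) * 2 * 2^s"
    proof -
      have "k div 2^Suc s = k div 2^s div 2" by (metis power_Suc2 div_mult2_eq)
      then show ?thesis unfolding trunc_def q_def by (simp only:) simp
    qed
    show "(t (trunc s) - t (trunc (Suc s)))\<^sup>2
        \<le> (\<Sum>j<2^(R-s). (t ((j+1) * 2^s) - t (j * 2^s))\<^sup>2)"
    proof (cases "even q")
      case True
      then have "trunc (Suc s) = trunc s" by (simp add: lo hi)
      then show ?thesis by (simp add: sum_nonneg)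
    next
      case False
      then have q: "q = (q - 1) + 1" "q div 2 * 2 = q - 1"
        by (auto elim!: oddE)
      then have "(t (trunc s) - t (trunc (Suc s)))\<^sup>2
          = (t ((q - 1 + 1) * 2^s) - t ((q - 1) * 2^s))\<^sup>2"
        using lo hi by metis
      also have "\<dots> \<le> (\<Sum>j<2^(R-s). (t ((j+1) * 2^s) - t (j * 2^s))\<^sup>2)"
        using q_le q by (intro member_le_sum[of "q - 1" _ "\<lambda>j. (t ((j+1) * 2^s) - t (j * 2^s))\<^sup>2"]) auto
      finally show ?thesis .
    qed
  qed auto
  finally show ?thesis by (simp add: mult.commute)
qed

text \<open>
  The other half: when variances grow at most linearly, each of the \<open>R + 1\<close> levels contributes
  at most \<open>2^R * V\<close>, whatever the length of its intervals.
\<close>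

lemma expectation_dyadic_energy_le:
  fixes T :: "'a \<Rightarrow> nat \<Rightarrow> real"
  assumes int: "\<And>k l. integrable M (\<lambda>\<omega>. (T \<omega> l - T \<omega> k)\<^sup>2)"
    and bound: "\<And>k l. k < l \<Longrightarrow> l \<le> 2^R \<Longrightarrow> (\<integral>\<omega>. (T \<omega> l - T \<omega> k)\<^sup>2 \<partial>M) \<le> V * real (l - k)"
  shows "integrable M (\<lambda>\<omega>. dyadic_energy (T \<omega>) R)"
    and "(\<integral>\<omega>. dyadic_energy (T \<omega>) R \<partial>M) \<le> real (R+1) * 2^R * V"
proof -
  show "integrable M (\<lambda>\<omega>. dyadic_energy (T \<omega>) R)"
    unfolding dyadic_energy_def by (intro Bochner_Integration.integrable_sum int)
  have "(\<integral>\<omega>. dyadic_energy (T \<omega>) R \<partial>M)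
      = (\<Sum>s\<le>R. \<Sum>j<2^(R-s). \<integral>\<omega>. (T \<omega> ((j+1) * 2^s) - T \<omega> (j * 2^s))\<^sup>2 \<partial>M)"
    unfolding dyadic_energy_def
    by (subst Bochner_Integration.integral_sum;
        (intro Bochner_Integration.integrable_sum int sum.cong refl Bochner_Integration.integral_sum)?)
  also have "\<dots> \<le> (\<Sum>s\<le>R. \<Sum>j<(2::nat)^(R-s). V * 2^s)"
  proof (intro sum_mono)
    fix s j :: nat assume "s \<in> {..R}" "j \<in> {..<2^(R-s)}"
    then have "(j + 1) * 2^s \<le> 2^(R-s) * 2^s" and "s \<le> R"
      by (auto intro!: mult_right_mono simp del: mult_Suc)
    then have "(j + 1) * 2^s \<le> 2^R"
      by (simp flip: power_add)
    from bound[OF _ this, of "j * 2^s"]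
    show "(\<integral>\<omega>. (T \<omega> ((j+1) * 2^s) - T \<omega> (j * 2^s))\<^sup>2 \<partial>M) \<le> V * 2^s"
      by simp
  qed
  also have "\<dots> = (\<Sum>s\<le>R. 2^R * V)"
  proof (intro sum.cong refl)
    fix s assume "s \<in> {..R}"
    then have "(2::real)^(R-s) * 2^s = 2^R" by (simp flip: power_add)
    then show "(\<Sum>j<(2::nat)^(R-s). V * 2^s) = 2^R * V" by simp
  qed
  also have "\<dots> = real (R+1) * 2^R * V" by (simp add: algebra_simps)
  finally show "(\<integral>\<omega>. dyadic_energy (T \<omega>) R \<partial>M) \<le> real (R+1) * 2^R * V" .
qed

section \<open>Almost sure convergence and variances of event counts\<close>

text \<open>
  By monotone convergence the sum of the \<open>X n\<close> is integrable, hence almost surely finite, and the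
  terms of a convergent series vanish in the limit.
\<close>

lemma AE_tendsto_zero_of_summable_expectation:
  fixes X :: "nat \<Rightarrow> 'a \<Rightarrow> real"
  assumes int: "\<And>n. integrable M (X n)" and nonneg: "\<And>n \<omega>. 0 \<le> X n \<omega>"
    and summ: "summable (\<lambda>n. \<integral>\<omega>. X n \<omega> \<partial>M)"
  shows "AE \<omega> in M. (\<lambda>n. X n \<omega>) \<longlonglongrightarrow> 0"
proof -
  have [measurable]: "X n \<in> borel_measurable M" for n using int by blast
  have "(\<integral>\<^sup>+\<omega>. (\<Sum>n. ennreal (X n \<omega>)) \<partial>M) = (\<Sum>n. \<integral>\<^sup>+\<omega>. ennreal (X n \<omega>) \<partial>M)"
    by (rule nn_integral_suminf) simp
  also have "\<dots> = (\<Sum>n. ennreal (\<integral>\<omega>. X n \<omega> \<partial>M))"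
    using int nonneg by (intro suminf_cong nn_integral_eq_integral) auto
  also have "\<dots> = ennreal (\<Sum>n. \<integral>\<omega>. X n \<omega> \<partial>M)"
    using summ nonneg by (intro suminf_ennreal2) auto
  finally have "(\<integral>\<^sup>+\<omega>. (\<Sum>n. ennreal (X n \<omega>)) \<partial>M) \<noteq> \<infinity>" by simp
  then have "AE \<omega> in M. (\<Sum>n. ennreal (X n \<omega>)) \<noteq> \<infinity>"
    by (intro nn_integral_noteq_infinite) auto
  then show ?thesis
  proof (eventually_elim)
    case (elim \<omega>)
    then have "summable (\<lambda>n. X n \<omega>)"
      using nonneg by (intro summable_suminf_not_top) auto
    then show ?case by (rule summable_LIMSEQ_zero)
  qed
qed

lemma event_mean_diff:
  assumes "m \<le> n"
  shows "event_mean M A n - event_mean M A m = (\<Sum>i\<in>{m<..n}. measure M (A i))"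
proof -
  have "{1..n} = {1..m} \<union> {m<..n}" using assms by auto
  then have "event_mean M A n = (\<Sum>i\<in>{1..m} \<union> {m<..n}. measure M (A i))"
    by (simp add: event_mean_def)
  also have "\<dots> = event_mean M A m + (\<Sum>i\<in>{m<..n}. measure M (A i))"
    unfolding event_mean_def by (rule sum.union_disjoint) auto
  finally show ?thesis by simp
qed

text \<open>
  Expanding the square gives the variances, at most \<open>prob (A i)\<close> each, and every covariance twice.
  Arranging each pair by its smaller index makes a one-sided bound on the total covariance of \<open>A i\<close>
  with later events sufficient; negative correlations can only help.
\<close>

lemma (in prob_space) variance_event_count_le:
  fixes A :: "nat \<Rightarrow> 'a set"
  assumes meas: "\<And>n. n \<ge> 1 \<Longrightarrow> A n \<in> sets M" and mn: "m \<le> n"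
    and excess: "\<And>i. m < i \<Longrightarrow> i \<le> n \<Longrightarrow>
      (\<Sum>j\<in>{i<..n}. prob (A i \<inter> A j) - prob (A i) * prob (A j)) \<le> W * prob (A i)"
  shows "(\<integral>\<omega>. ((event_count A n \<omega> - event_mean M A n) - (event_count A m \<omega> - event_mean M A m))\<^sup>2 \<partial>M)
    \<le> (1 + 2 * W) * (event_mean M A n - event_mean M A m)"
proof -
  define I where "I = {m<..n}"
  define p where "p i = prob (A i)" for i
  define d where "d i \<omega> = indicator (A i) \<omega> - p i" for i \<omega>
  define C where "C i j = prob (A i \<inter> A j) - p i * p j" for i j
  have sets_I: "A i \<in> sets M" if "i \<in> I" for i using meas that by (auto simp: I_def)
  have split: "{1..n} = {1..m} \<union> I" "{1..m} \<inter> I = {}" using mn by (auto simp: I_def)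
  have count: "event_count A n \<omega> = event_count A m \<omega> + (\<Sum>i\<in>I. indicator (A i) \<omega>)" for \<omega>
    unfolding event_count_def split by (rule sum.union_disjoint) (use split in \<open>auto simp: I_def\<close>)
  have mean: "event_mean M A n = event_mean M A m + (\<Sum>i\<in>I. p i)"
    using event_mean_diff[OF mn, of M A] by (simp add: I_def p_def)
  have int_d: "integrable M (\<lambda>\<omega>. d i \<omega> * d j \<omega>)"
    and E_d: "(\<integral>\<omega>. d i \<omega> * d j \<omega> \<partial>M) = C i j" if "i \<in> I" "j \<in> I" for i j
  proof -
    have [measurable]: "A i \<in> sets M" "A j \<in> sets M" using sets_I that by auto
    have eq: "d i \<omega> * d j \<omega> = indicator (A i \<inter> A j) \<omega> - p j * indicator (A i) \<omega>
        - p i * indicator (A j) \<omega> + p i * p j" for \<omega>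
      by (simp add: d_def indicator_inter_arith algebra_simps)
    show "integrable M (\<lambda>\<omega>. d i \<omega> * d j \<omega>)"
      unfolding eq by (auto simp: integrable_indicator_iff less_top[symmetric])
    show "(\<integral>\<omega>. d i \<omega> * d j \<omega> \<partial>M) = C i j"
      unfolding eq by (simp add: C_def p_def less_top[symmetric] prob_space)
  qed
  have "(\<integral>\<omega>. ((event_count A n \<omega> - event_mean M A n) - (event_count A m \<omega> - event_mean M A m))\<^sup>2 \<partial>M)
      = (\<integral>\<omega>. (\<Sum>i\<in>I. \<Sum>j\<in>I. d i \<omega> * d j \<omega>) \<partial>M)"
    by (simp add: count mean d_def power2_eq_square sum_product[symmetric] sum_subtractf)
  also have "\<dots> = (\<Sum>i\<in>I. \<Sum>j\<in>I. C i j)"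
    by (subst Bochner_Integration.integral_sum;
        (intro Bochner_Integration.integrable_sum int_d sum.cong refl
          trans[OF Bochner_Integration.integral_sum])?; (simp add: int_d E_d)?)
  also have "\<dots> = (\<Sum>i\<in>I. C i i + (\<Sum>j\<in>{j\<in>I. i < j}. C i j) + (\<Sum>j\<in>{j\<in>I. j < i}. C i j))"
  proof (intro sum.cong refl)
    fix i assume i: "i \<in> I"
    have "I = insert i ({j\<in>I. i < j} \<union> {j\<in>I. j < i})" using i by auto
    then have "sum (C i) I = sum (C i) (insert i ({j\<in>I. i < j} \<union> {j\<in>I. j < i}))" by simp
    also have "\<dots> = C i i + (\<Sum>j\<in>{j\<in>I. i < j}. C i j) + (\<Sum>j\<in>{j\<in>I. j < i}. C i j)"
      by (subst sum.insert; (subst sum.union_disjoint)?) (auto simp: I_def)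
    finally show "sum (C i) I = C i i + (\<Sum>j\<in>{j\<in>I. i < j}. C i j) + (\<Sum>j\<in>{j\<in>I. j < i}. C i j)" .
  qed
  also have "\<dots> = (\<Sum>i\<in>I. C i i + 2 * (\<Sum>j\<in>{j\<in>I. i < j}. C i j))"
  proof -
    have "(\<Sum>i\<in>I. \<Sum>j\<in>{j\<in>I. j < i}. C i j) = (\<Sum>j\<in>I. \<Sum>i\<in>{i\<in>I. j < i}. C i j)"
      by (rule sum.swap_restrict) (auto simp: I_def)
    also have "\<dots> = (\<Sum>i\<in>I. \<Sum>j\<in>{j\<in>I. i < j}. C i j)"
      by (simp add: C_def Int_commute mult.commute)
    finally show ?thesis by (simp add: sum.distrib sum_distrib_left)
  qed
  also have "\<dots> \<le> (\<Sum>i\<in>I. p i + 2 * (W * p i))"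
  proof (intro sum_mono add_mono mult_left_mono)
    fix i assume i: "i \<in> I"
    show "C i i \<le> p i" by (simp add: C_def p_def)
    have "{j\<in>I. i < j} = {i<..n}" using i by (auto simp: I_def)
    then show "(\<Sum>j\<in>{j\<in>I. i < j}. C i j) \<le> W * p i"
      using excess[of i] i by (simp add: C_def p_def I_def)
  qed simp
  also have "\<dots> = (1 + 2 * W) * (event_mean M A n - event_mean M A m)"
    by (simp add: mean sum_distrib_left distrib_right mult.assoc sum.distrib)
  finally show ?thesis .
qed

section \<open>Sampling at unit speed of the mean\<close>

definition first_index :: "(nat \<Rightarrow> real) \<Rightarrow> nat \<Rightarrow> nat" where
  "first_index u k = (LEAST n. real k \<le> u n)"

text \<open>
  A sequence of means of event counts starts at \<open>0\<close>, increases by at most \<open>1\<close> per step and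
  diverges. Sampled at the first indices where it reaches \<open>0, 1, 2, ...\<close>, it runs at unit speed up to
  an error less than one.
\<close>

context
  fixes u :: "nat \<Rightarrow> real"
  assumes u_mono: "mono u" and u_0: "u 0 = 0" and u_step: "\<And>n. u (Suc n) \<le> u n + 1"
    and u_top: "filterlim u at_top sequentially"
begin

lemma first_index_ge: "real k \<le> u (first_index u k)"
proof -
  have "\<exists>n. real k \<le> u n"
    using u_top by (auto simp: filterlim_at_top eventually_sequentially)
  then show ?thesis unfolding first_index_def by (rule LeastI_ex)
qed

lemma first_index_le: "real k \<le> u n \<Longrightarrow> first_index u k \<le> n"
  unfolding first_index_def by (rule Least_le)

lemma le_first_index: "u n < real k \<Longrightarrow> n \<le> first_index u k"
  using first_index_ge[of k] monoD[OF u_mono, of "first_index u k" n] by linarith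

lemma first_index_mono: "k \<le> l \<Longrightarrow> first_index u k \<le> first_index u l"
  by (rule first_index_le) (use first_index_ge[of l] in linarith)

lemma first_index_less: "u (first_index u k) < real k + 1"
proof (cases "first_index u k")
  case 0
  then show ?thesis by (simp add: u_0)
next
  case (Suc n)
  have "\<not> real k \<le> u n" using first_index_le[of k n] Suc by auto
  then show ?thesis using u_step[of n] Suc by simp
qed

lemma first_index_0: "first_index u 0 = 0"
  using first_index_le[of 0 0] u_0 by simp

text \<open>
  Between two consecutive sampling points both sequences are monotone, so \<open>s n\<close> is enclosed by its
  values at these points, while \<open>u\<close> changes by less than \<open>2\<close> from \<open>n\<close> to either of them.
\<close>

lemma deviation_sandwich:
  fixes s :: "nat \<Rightarrow> real"
  assumes s: "mono s" and k: "real k \<le> u n" "u n < real k + 1"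
    and Q: "\<And>l. l \<le> k + 1 \<Longrightarrow> (s (first_index u l) - u (first_index u l))\<^sup>2 \<le> Q"
  shows "(s n - u n)\<^sup>2 \<le> 2 * Q + 8"
proof -
  define t where "t l = s (first_index u l) - u (first_index u l)" for l
  have root: "\<bar>t l\<bar> \<le> sqrt Q" if "l \<le> k + 1" for l
    using Q[OF that] real_sqrt_le_mono[of "(t l)\<^sup>2" Q] by (simp add: t_def)
  have "0 \<le> Q" using Q[of 0] zero_le_power2 order_trans by blast
  have "s n - u n \<le> t (k+1) + 2"
    using monoD[OF s le_first_index[of n "k+1"]] first_index_less[of "k+1"] k by (simp add: t_def)
  moreover have "t k - 2 \<le> s n - u n"
    using monoD[OF s first_index_le[of k n]] first_index_ge[of k] k by (simp add: t_def)
  ultimately have "\<bar>s n - u n\<bar> \<le> sqrt Q + 2"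
    using root[of k] root[of "k+1"] by simp
  then have "(s n - u n)\<^sup>2 \<le> (sqrt Q + 2)\<^sup>2"
    using abs_le_square_iff[of "s n - u n" "sqrt Q + 2"] \<open>0 \<le> Q\<close> by simp
  also have "\<dots> \<le> 2 * Q + 8"
    using \<open>0 \<le> Q\<close> zero_le_power2[of "sqrt Q - 2"] by (simp add: power2_eq_square algebra_simps)
  finally show ?thesis .
qed

end

section \<open>The rate of convergence from variance growth\<close>

text \<open>
  The strong law with rate, from a variance bound alone. The blocks \<open>4^r \<le> E n < 4^(r+1)\<close> have
  ratio \<open>4\<close> rather than \<open>2\<close> because \<open>ln 4 \<ge> 1\<close>: then \<open>ln (E n) \<ge> r\<close>, and \<open>\<psi> (ln (E n))\<close> dominates
  the value \<open>\<psi> r\<close> occurring in the summability hypothesis. The power \<open>3/2\<close> of the logarithm is what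
  remains of \<open>r\<^sup>2\<close> from the maximal inequality and \<open>r\<close> from the convergence of the series.
\<close>

lemma (in prob_space) as_eq_little_o_of_variance_growth:
  fixes A :: "nat \<Rightarrow> 'a set" and \<psi> F :: "real \<Rightarrow> real" and K :: real
  assumes meas: "\<And>n. n \<ge> 1 \<Longrightarrow> A n \<in> sets M"
    and E_top: "filterlim (event_mean M A) at_top sequentially"
    and psi_mono: "mono_on {0..} \<psi>"
    and psi_pos: "\<And>x. x \<ge> 0 \<Longrightarrow> \<psi> x > 0"
    and psi_summable: "summable (\<lambda>n. 1 / (real (Suc n) * \<psi> (real (Suc n))))"
    and F_pos: "\<And>x. x \<ge> 1 \<Longrightarrow> F x > 0"
    and F_mono: "\<And>x y. 1 \<le> x \<Longrightarrow> x \<le> y \<Longrightarrow> F x \<le> F y"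
    and F_scale: "\<And>a x. 1 \<le> a \<Longrightarrow> 1 \<le> x \<Longrightarrow> F (a * x) \<le> a * F x"
    and K_nonneg: "0 \<le> K"
    and variance: "\<And>m n y. m \<le> n \<Longrightarrow> 1 \<le> y \<Longrightarrow> event_mean M A n - event_mean M A m \<le> y \<Longrightarrow>
      (\<integral>\<omega>. ((event_count A n \<omega> - event_mean M A n) - (event_count A m \<omega> - event_mean M A m))\<^sup>2 \<partial>M)
        \<le> K * y * F y"
  shows "as_eq_little_o M (event_count A) (event_mean M A)
    (\<lambda>n. error_rate (\<lambda>x. x * F x) \<psi> (event_mean M A n))"
proof -
  define u where "u = event_mean M A"
  define N where "N = first_index u"
  have u_mono: "mono u"
    by (rule incseq_SucI) (simp add: u_def event_mean_def)
  have u_0: "u 0 = 0" by (simp add: u_def event_mean_def)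
  have u_step: "u (Suc n) \<le> u n + 1" for n by (simp add: u_def event_mean_def)
  have u_top: "filterlim u at_top sequentially" using E_top by (simp add: u_def)
  note idx = u_mono u_0 u_step u_top
  have count_mono: "mono (\<lambda>n. event_count A n \<omega>)" for \<omega>
    by (rule incseq_SucI) (simp add: event_count_def)
  define T where "T \<omega> k = event_count A (N k) \<omega> - u (N k)" for \<omega> k
  have T_0: "T \<omega> 0 = 0" for \<omega>
    by (simp add: T_def N_def first_index_0[OF idx] u_0 event_count_def)
  have count_meas: "event_count A n \<in> borel_measurable M" for n
    unfolding event_count_def
    by (intro borel_measurable_sum borel_measurable_indicator meas) auto
  have int_T: "integrable M (\<lambda>\<omega>. (T \<omega> l - T \<omega> k)\<^sup>2)" for k l
  proof (rule integrable_const_bound)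
    have count_bound: "\<bar>event_count A n \<omega>\<bar> \<le> real n" for n \<omega>
    proof -
      have "\<bar>event_count A n \<omega>\<bar> \<le> (\<Sum>k=1..n. 1)"
        unfolding event_count_def by (rule order_trans[OF sum_abs sum_mono]) (simp add: indicator_def)
      then show ?thesis by simp
    qed
    define B where "B = real (N l) + \<bar>u (N l)\<bar> + real (N k) + \<bar>u (N k)\<bar>"
    have "\<bar>T \<omega> l - T \<omega> k\<bar> \<le> \<bar>B\<bar>" for \<omega>
      unfolding T_def B_def using count_bound[of "N l" \<omega>] count_bound[of "N k" \<omega>] by linarith
    then show "AE \<omega> in M. norm ((T \<omega> l - T \<omega> k)\<^sup>2) \<le> B\<^sup>2"
      by (intro AE_I2) (simp add: abs_le_square_iff)
    show "(\<lambda>\<omega>. (T \<omega> l - T \<omega> k)\<^sup>2) \<in> borel_measurable M"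
      unfolding T_def using count_meas by measurable
  qed
  have E_T: "(\<integral>\<omega>. (T \<omega> l - T \<omega> k)\<^sup>2 \<partial>M) \<le> (16 * K * F (4^r)) * real (l - k)"
    if "k < l" "l \<le> 4^(r+1)" for k l r
  proof -
    \<comment> \<open>Sampling overshoots by less than one, so the mean grows by at most \<open>l - k + 1 \<le> 2 * (l - k)\<close>.\<close>
    define y where "y = 2 * real (l - k)"
    have "u (N l) - u (N k) \<le> y"
      using first_index_less[OF idx, of l] first_index_ge[OF idx, of k] that
      by (simp add: y_def N_def)
    moreover have y1: "1 \<le> y" using that by (simp add: y_def)
    ultimately have "(\<integral>\<omega>. (T \<omega> l - T \<omega> k)\<^sup>2 \<partial>M) \<le> K * y * F y"
      using variance[of "N k" "N l" y] first_index_mono[OF idx, of k l] that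
      by (simp add: T_def N_def u_def)
    also have "\<dots> \<le> K * y * (8 * F (4^r))"
    proof (intro mult_left_mono)
      have "real l \<le> real (4^(r+1))" using that(2) by (simp only: of_nat_le_iff)
      then have "y \<le> 8 * 4^r" by (simp add: y_def)
      then have "F y \<le> F (8 * 4^r)" using y1 by (intro F_mono)
      also have "\<dots> \<le> 8 * F (4^r)" by (intro F_scale) auto
      finally show "F y \<le> 8 * F (4^r)" .
    qed (use K_nonneg y1 in auto)
    finally show ?thesis by (simp add: y_def mult_ac)
  qed
  \<comment> \<open>The maximum over a block, in the form of a dyadic energy over \<open>2^(2*r+2) = 4^(r+1)\<close> steps;
    \<open>H r\<close> bounds the squared error rate in the block from below, and \<open>2*r+3\<close> is the number of dyadic levels.\<close>
  define D where "D r \<omega> = dyadic_energy (T \<omega>) (2*r+2)" for r \<omega>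
  define H where "H r = 4^r * F (4^r) * \<psi> (real r) * real r ^ 3" for r
  define G where "G r \<omega> = (2 * real r + 3) * D r \<omega> / H r" for r \<omega>
  have four_pow: "(2::'b::{semiring_1,monoid_mult})^(2*r+2) = 4^(r+1)" for r
    using power_mult[of "2::'b" 2 "r+1"] by simp
  have H_pos: "0 < H r" if "r \<ge> 1" for r
    using that F_pos[of "4^r"] psi_pos[of "real r"] by (simp add: H_def)
  have int_D: "integrable M (D r)" and E_D: "(\<integral>\<omega>. D r \<omega> \<partial>M) \<le> (2 * real r + 3) * 4^(r+1) * (16 * K * F (4^r))" for r
  proof -
    note en = expectation_dyadic_energy_le[of M T "2*r+2" "16 * K * F (4^r)", OF int_T]
    have b: "(\<integral>\<omega>. (T \<omega> l - T \<omega> k)\<^sup>2 \<partial>M) \<le> (16 * K * F (4^r)) * real (l - k)"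
      if "k < l" "l \<le> 2^(2*r+2)" for k l
      using E_T[of k l r] that by (simp only: four_pow)
    show "integrable M (D r)" unfolding D_def using en(1) b by blast
    have "(\<integral>\<omega>. D r \<omega> \<partial>M) \<le> real (2*r+2+1) * 2^(2*r+2) * (16 * K * F (4^r))"
      unfolding D_def using en(2) b by blast
    then show "(\<integral>\<omega>. D r \<omega> \<partial>M) \<le> (2 * real r + 3) * 4^(r+1) * (16 * K * F (4^r))"
      by (simp only: four_pow) (simp add: algebra_simps)
  qed
  have G_nonneg: "0 \<le> G r \<omega>" if "r \<ge> 1" for r \<omega>
    using H_pos[OF that] dyadic_energy_nonneg[of "T \<omega>" "2*r+2"] by (simp add: G_def D_def)
  have int_G: "integrable M (G r)" for r
    unfolding G_def by (intro integrable_divide_zero integrable_mult_right) (simp add: int_D)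
  have E_G: "(\<integral>\<omega>. G r \<omega> \<partial>M) \<le> 1600 * K * (1 / (real r * \<psi> (real r)))" if r: "r \<ge> 1" for r
  proof -
    have "(\<integral>\<omega>. G r \<omega> \<partial>M) = (2 * real r + 3) * (\<integral>\<omega>. D r \<omega> \<partial>M) / H r"
      unfolding G_def by simp
    also have "\<dots> \<le> (2 * real r + 3) * ((2 * real r + 3) * 4^(r+1) * (16 * K * F (4^r))) / H r"
      using E_D[of r] H_pos[OF r] by (intro divide_right_mono mult_left_mono) auto
    also have "\<dots> = (2 * real r + 3)\<^sup>2 * (64 * 4^r * K * F (4^r)) / H r"
      by (simp add: power2_eq_square)
    also have "\<dots> \<le> (5 * real r)\<^sup>2 * (64 * 4^r * K * F (4^r)) / H r"
      using r H_pos[OF r] F_pos[of "4^r"] K_nonneg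
      by (intro divide_right_mono mult_right_mono power_mono) (auto intro!: mult_nonneg_nonneg less_imp_le)
    also have "\<dots> = 1600 * K * (1 / (real r * \<psi> (real r)))"
    proof -
      have "F (4^r) \<noteq> 0" "\<psi> (real r) \<noteq> 0" using F_pos[of "4^r"] psi_pos[of "real r"] by auto
      then show ?thesis using r by (simp add: H_def field_simps power2_eq_square power3_eq_cube)
    qed
    finally show ?thesis .
  qed
  have AE_G: "AE \<omega> in M. (\<lambda>r. G (Suc r) \<omega>) \<longlonglongrightarrow> 0"
  proof (rule AE_tendsto_zero_of_summable_expectation)
    show "summable (\<lambda>r. \<integral>\<omega>. G (Suc r) \<omega> \<partial>M)"
    proof (rule summable_comparison_test')
      show "summable (\<lambda>r. 1600 * K * (1 / (real (Suc r) * \<psi> (real (Suc r)))))"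
        by (intro summable_mult psi_summable)
      show "norm (\<integral>\<omega>. G (Suc r) \<omega> \<partial>M) \<le> 1600 * K * (1 / (real (Suc r) * \<psi> (real (Suc r))))"
        if "r \<ge> 0" for r
        using E_G[of "Suc r"] G_nonneg[of "Suc r"] by (simp add: integral_nonneg)
    qed
  qed (use int_G G_nonneg in auto)
  have H_top: "filterlim (\<lambda>r. H (Suc r)) at_top sequentially"
  proof (rule filterlim_at_top_mono)
    show "filterlim (\<lambda>r. (F 1 * \<psi> 1) * real r) at_top sequentially"
      using F_pos[of 1] psi_pos[of 1]
      by (intro filterlim_tendsto_pos_mult_at_top[OF tendsto_const _ filterlim_real_sequentially]) auto
    show "\<forall>\<^sub>F r in sequentially. F 1 * \<psi> 1 * real r \<le> H (Suc r)"
    proof (intro always_eventually allI)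
      fix r
      have "F 1 * \<psi> 1 * real r \<le> (F (4^Suc r) * \<psi> (real (Suc r))) * (4^Suc r * real (Suc r) ^ 3)"
      proof (intro mult_mono)
        show "F 1 \<le> F (4^Suc r)" by (intro F_mono) (auto simp del: power_Suc)
        show "\<psi> 1 \<le> \<psi> (real (Suc r))" by (rule mono_onD[OF psi_mono]) auto
        have "real r \<le> 1 * real (Suc r) ^ 1" by simp
        also have "\<dots> \<le> 4^Suc r * real (Suc r) ^ 3"
          by (intro mult_mono power_increasing one_le_power) auto
        finally show "real r \<le> 4^Suc r * real (Suc r) ^ 3" .
        show "0 \<le> F (4^Suc r)" "0 \<le> \<psi> 1" "0 \<le> F (4^Suc r) * \<psi> (real (Suc r))"
          using F_pos[of "4^Suc r", OF one_le_power] psi_pos[of 1] psi_pos[of "real (Suc r)"]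
          by (auto simp del: power_Suc)
      qed auto
      then show "F 1 * \<psi> 1 * real r \<le> H (Suc r)" by (simp add: H_def mult_ac)
    qed
  qed
  \<comment> \<open>The predecessor of the index \<open>r\<close> of the block containing \<open>u n\<close>, since the limits above run over \<open>Suc r\<close>.\<close>
  define block where "block n = nat \<lfloor>log 4 (u n)\<rfloor> - 1" for n
  have block_top: "filterlim block at_top sequentially"
  proof -
    have "filterlim (\<lambda>n. log 4 (u n)) at_top sequentially"
      unfolding log_def divide_inverse mult.commute[of _ "inverse (ln 4)"]
      by (intro filterlim_tendsto_pos_mult_at_top[OF tendsto_const]
          filterlim_compose[OF ln_at_top u_top]) simp
    then have "filterlim (\<lambda>n. nat \<lfloor>log 4 (u n)\<rfloor>) at_top sequentially"
      by (intro filterlim_compose[OF filterlim_nat_sequentially]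
          filterlim_compose[OF filterlim_floor_sequentially])
    then show ?thesis unfolding block_def
      by (rule filterlim_compose[OF filterlim_minus_const_nat_at_top])
  qed
  have sq_le: "((event_count A n \<omega> - u n) / error_rate (\<lambda>x. x * F x) \<psi> (u n))\<^sup>2
      \<le> 2 * G (Suc (block n)) \<omega> + 8 / H (Suc (block n))" if un: "4 \<le> u n" for n \<omega>
  proof -
    define r where "r = Suc (block n)"
    have "1 \<le> log 4 (u n)" using un by (simp add: le_log_iff)
    then have r_eq: "int r = \<lfloor>log 4 (u n)\<rfloor>" and r1: "r \<ge> 1"
      unfolding r_def block_def by linarith+
    then have "real r \<le> log 4 (u n)" "log 4 (u n) < real r + 1"
      by linarith+
    then have lo: "4^r \<le> u n" and hi: "u n < 4^(r+1)"
      using un by (auto simp: le_log_iff log_less_iff powr_realpow powr_add)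
    define k where "k = nat \<lfloor>u n\<rfloor>"
    have k: "real k \<le> u n" "u n < real k + 1" unfolding k_def using un by linarith+
    have "real k < real (4^(r+1))" using k hi by simp
    then have "k < 4^(r+1)" by (simp only: of_nat_less_iff)
    have "(event_count A n \<omega> - u n)\<^sup>2 \<le> 2 * ((2 * real r + 3) * D r \<omega>) + 8"
    proof (rule deviation_sandwich[OF idx, of "\<lambda>n. event_count A n \<omega>" k])
      fix l assume "l \<le> k + 1"
      then have "l \<le> 4^(r+1)" using \<open>k < 4^(r+1)\<close> by simp
      then have "l \<le> 2^(2*r+2)" by (simp only: four_pow)
      from dyadic_chaining[OF this, of "T \<omega>"]
      show "(event_count A (first_index u l) \<omega> - u (first_index u l))\<^sup>2 \<le> (2 * real r + 3) * D r \<omega>"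
        by (simp add: T_0 D_def) (simp add: T_def N_def algebra_simps)
    qed (use count_mono k in auto)
    moreover have "H r \<le> (error_rate (\<lambda>x. x * F x) \<psi> (u n))\<^sup>2"
    proof -
      have "real r * 1 \<le> real r * ln 4"
        using ln2_ge_two_thirds ln_realpow[of 2 2] by (intro mult_left_mono) auto
      also have "\<dots> = ln (4^r)" by (simp add: ln_realpow)
      also have "\<dots> \<le> ln (u n)" using lo un by simp
      finally have ln_ge: "real r \<le> ln (u n)" by simp
      have pos: "0 < F (u n)" "0 < \<psi> (ln (u n))" "0 < ln (u n)"
        using F_pos[of "u n"] psi_pos[of "ln (u n)"] un by auto
      have "H r \<le> u n * F (u n) * \<psi> (ln (u n)) * ln (u n) ^ 3"
        unfolding H_def
      proof (intro mult_mono power_mono)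
        show "F (4^r) \<le> F (u n)" using lo by (intro F_mono) auto
        show "\<psi> (real r) \<le> \<psi> (ln (u n))" using ln_ge by (intro mono_onD[OF psi_mono]) auto
      qed (use lo ln_ge un pos F_pos[of "4^r"] psi_pos[of "real r"] in \<open>auto intro!: mult_nonneg_nonneg\<close>)
      also have "\<dots> = (error_rate (\<lambda>x. x * F x) \<psi> (u n))\<^sup>2"
      proof -
        have "(ln (u n) powr (3/2))\<^sup>2 = ln (u n) ^ 3"
          using pos by (simp add: power2_eq_square flip: powr_add)
        then show ?thesis using pos un by (simp add: error_rate_def power_mult_distrib)
      qed
      finally show ?thesis .
    qed
    ultimately have "(event_count A n \<omega> - u n)\<^sup>2 / (error_rate (\<lambda>x. x * F x) \<psi> (u n))\<^sup>2
        \<le> (2 * ((2 * real r + 3) * D r \<omega>) + 8) / H r"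
      using H_pos[OF r1] by (intro frac_le) (auto intro: order_trans[OF zero_le_power2])
    also have "\<dots> = 2 * G r \<omega> + 8 / H r" by (simp add: G_def add_divide_distrib)
    finally show ?thesis by (simp add: r_def power_divide)
  qed
  from AE_G show ?thesis
    unfolding as_eq_little_o_def u_def[symmetric]
  proof (eventually_elim)
    case (elim \<omega>)
    have "(\<lambda>r. 2 * G (Suc r) \<omega> + 8 / H (Suc r)) \<longlonglongrightarrow> 2 * 0 + 0"
      using H_top elim
      by (intro tendsto_add tendsto_mult tendsto_const real_tendsto_divide_at_top[OF tendsto_const])
    then have lim: "(\<lambda>n. 2 * G (Suc (block n)) \<omega> + 8 / H (Suc (block n))) \<longlonglongrightarrow> 0"
      using filterlim_compose[OF _ block_top] by fastforce
    have "(\<lambda>n. ((event_count A n \<omega> - u n) / error_rate (\<lambda>x. x * F x) \<psi> (u n))\<^sup>2) \<longlonglongrightarrow> 0"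
    proof (rule tendsto_sandwich[OF _ _ tendsto_const lim])
      show "\<forall>\<^sub>F n in sequentially. ((event_count A n \<omega> - u n) / error_rate (\<lambda>x. x * F x) \<psi> (u n))\<^sup>2
          \<le> 2 * G (Suc (block n)) \<omega> + 8 / H (Suc (block n))"
        using filterlim_at_top[THEN iffD1, OF u_top, rule_format, of 4]
        by (eventually_elim) (rule sq_le)
    qed simp
    from tendsto_real_sqrt[OF this] show ?case
      by (simp add: tendsto_rabs_zero_iff del: abs_divide)
  qed
qed

section \<open>Sums with decaying weights\<close>

text \<open>
  All the sums over gaps \<open>j - i\<close> are partial sums of one series, so a single bound serves every \<open>i\<close>
  and \<open>n\<close>, even if the series has terms of both signs and converges only conditionally.
\<close>

lemma partial_sums_bounded_above:
  fixes b :: "nat \<Rightarrow> real"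
  assumes "summable (\<lambda>n. b (Suc n))"
  obtains B where "0 \<le> B" "\<And>i n. (\<Sum>j\<in>{i<..n}. b (j - i)) \<le> B"
proof -
  have "Bseq (\<lambda>n. \<Sum>k<n. b (Suc k))"
    using assms by (intro convergent_imp_Bseq) (simp add: summable_iff_convergent)
  then obtain B where B: "0 < B" "\<And>n. norm (\<Sum>k<n. b (Suc k)) \<le> B"
    by (auto elim: BseqE)
  show thesis
  proof (rule that)
    fix i n :: nat
    have "(\<Sum>j\<in>{i<..n}. b (j - i)) = (\<Sum>k<n-i. b (Suc k))"
      by (rule sum.reindex_bij_witness[of _ "\<lambda>k. i + Suc k" "\<lambda>j. j - i - 1"]) (auto simp: Suc_diff_Suc)
    then show "(\<Sum>j\<in>{i<..n}. b (j - i)) \<le> B" using B(2)[of "n-i"] by simp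
  qed (use B in simp)
qed

text \<open>
  Indices at distance at most \<open>z\<close> are few, and each contributes at most \<open>c 0\<close>; all others carry a
  weight of at most \<open>c z\<close>. The cut \<open>z\<close> is left free, to be chosen where both parts balance.
\<close>

lemma decaying_weights_sum_le:
  fixes c :: "real \<Rightarrow> real" and p :: "nat \<Rightarrow> real"
  assumes c_nonneg: "\<And>x. 0 \<le> x \<Longrightarrow> 0 \<le> c x" and c_anti: "antimono_on {0..} c"
    and p: "\<And>j. 0 \<le> p j" "\<And>j. p j \<le> 1" and z: "0 \<le> z"
  shows "(\<Sum>j\<in>{i<..n}. c (real (j - i)) * p j) \<le> c 0 * z + c z * (\<Sum>j\<in>{i<..n}. p j)"
proof -
  have anti: "c y \<le> c x" if "0 \<le> x" "x \<le> y" for x y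
    using monotone_onD[OF c_anti, of x y] that by auto
  have "(\<Sum>j\<in>{i<..n}. c (real (j - i)) * p j)
      \<le> (\<Sum>j\<in>{i<..n}. (if real (j - i) \<le> z then c 0 else 0) + c z * p j)"
  proof (rule sum_mono)
    fix j
    show "c (real (j - i)) * p j \<le> (if real (j - i) \<le> z then c 0 else 0) + c z * p j"
    proof (cases "real (j - i) \<le> z")
      case True
      have "c (real (j - i)) * p j \<le> c 0 * 1"
        using anti[of 0 "real (j - i)"] c_nonneg p by (intro mult_mono) auto
      moreover have "0 \<le> c z * p j" using c_nonneg z p by simp
      ultimately show ?thesis using True by simp
    next
      case False
      then show ?thesis using anti[of z "real (j - i)"] z p by (simp add: mult_right_mono del: of_nat_diff)
    qed
  qed
  also have "\<dots> = c 0 * real (card {j\<in>{i<..n}. real (j - i) \<le> z}) + c z * (\<Sum>j\<in>{i<..n}. p j)"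
    by (simp add: sum.distrib sum_distrib_left del: of_nat_diff flip: sum.inter_filter)
  also have "\<dots> \<le> c 0 * z + c z * (\<Sum>j\<in>{i<..n}. p j)"
  proof -
    have "{j\<in>{i<..n}. real (j - i) \<le> z} \<subseteq> {i<..i + nat \<lfloor>z\<rfloor>}"
      using z by (auto simp: le_nat_floor) linarith
    from card_mono[OF _ this] have "card {j\<in>{i<..n}. real (j - i) \<le> z} \<le> nat \<lfloor>z\<rfloor>" by simp
    then have "real (card {j\<in>{i<..n}. real (j - i) \<le> z}) \<le> z" using z by linarith
    then show ?thesis using c_nonneg[of 0] by (simp add: mult_left_mono)
  qed
  finally show ?thesis .
qed

section \<open>The inverse of a quotient with decreasing denominator\<close>

text \<open>
  The inverse \<open>F\<close> of \<open>f x = x / c x\<close> satisfies \<open>F(x) = x * c (F(x))\<close>. It thus grows, but no faster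
  than linearly, because the factor \<open>c (F(x))\<close> decreases.
\<close>

context
  fixes c f :: "real \<Rightarrow> real"
  assumes c_pos: "\<And>x. x \<ge> 0 \<Longrightarrow> c x > 0"
    and c_anti: "antimono_on {0..} c"
    and c_cont: "continuous_on {0..} c"
    and f_eq: "\<And>x. x \<ge> 0 \<Longrightarrow> f x = x / c x"
    and f_strict: "strict_mono_on {0..} f"
begin

text \<open>
  By the intermediate value theorem, as \<open>f 0 = 0\<close> and \<open>f w \<ge> w / c 0\<close>. Only because of this does
  \<open>inv_into\<close> give a genuine inverse at every nonnegative argument.
\<close>

lemma range_quotient:
  assumes "0 \<le> x"
  shows "x \<in> f ` {0..}"
proof -
  define w where "w = x * c 0"
  have w: "0 \<le> w" using assms c_pos[of 0] by (simp add: w_def)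
  have cw: "c w \<le> c 0" using monotone_onD[OF c_anti, of 0 w] w by auto
  have "x = w / c 0" using c_pos[of 0] by (simp add: w_def)
  also have "\<dots> \<le> f w"
    using w cw c_pos[of w] f_eq[of w] by (simp add: frac_le)
  finally have "x \<le> f w" .
  moreover have "f 0 \<le> x" using f_eq[of 0] assms by simp
  moreover have "continuous_on {0..w} f"
  proof -
    have "continuous_on {0..w} (\<lambda>x. x / c x)"
      using c_pos by (intro continuous_intros continuous_on_subset[OF c_cont]) (auto simp: less_imp_neq[symmetric])
    then show ?thesis by (rule continuous_on_eq) (simp add: f_eq)
  qed
  ultimately obtain v where "0 \<le> v" "v \<le> w" "f v = x"
    using IVT'[of f 0 x w] w by blast
  then show ?thesis by auto
qed

lemma inverse_quotient_nonneg: "0 \<le> x \<Longrightarrow> 0 \<le> inv_into {0..} f x"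
  using inv_into_into[OF range_quotient, of x] by simp

lemma inverse_quotient_fixpoint:
  assumes "0 \<le> x"
  shows "inv_into {0..} f x = x * c (inv_into {0..} f x)"
proof -
  have "x = inv_into {0..} f x / c (inv_into {0..} f x)"
    using f_inv_into_f[OF range_quotient, of x] f_eq inverse_quotient_nonneg assms by simp
  then show ?thesis
    using c_pos[OF inverse_quotient_nonneg[OF assms]] by (simp add: field_simps)
qed

lemma inverse_quotient_pos: "0 < x \<Longrightarrow> 0 < inv_into {0..} f x"
  using inverse_quotient_fixpoint[of x] c_pos[OF inverse_quotient_nonneg, of x]
  by (metis less_imp_le mult_pos_pos)

lemma inverse_quotient_mono:
  assumes "0 \<le> x" "x \<le> y"
  shows "inv_into {0..} f x \<le> inv_into {0..} f y"
proof (rule ccontr)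
  assume "\<not> ?thesis"
  then have "f (inv_into {0..} f y) < f (inv_into {0..} f x)"
    using inverse_quotient_nonneg assms by (intro strict_mono_onD[OF f_strict]) auto
  then show False
    using f_inv_into_f[OF range_quotient, of x] f_inv_into_f[OF range_quotient, of y] assms by simp
qed

lemma inverse_quotient_scale:
  assumes "1 \<le> a" "0 \<le> x"
  shows "inv_into {0..} f (a * x) \<le> a * inv_into {0..} f x"
proof -
  have xax: "x \<le> a * x" using assms mult_right_mono[of 1 a x] by simp
  then have "c (inv_into {0..} f (a * x)) \<le> c (inv_into {0..} f x)"
    using assms inverse_quotient_nonneg inverse_quotient_mono[of x "a * x"]
    by (intro monotone_onD[OF c_anti, of _ _, simplified]) auto
  then have "a * x * c (inv_into {0..} f (a * x)) \<le> a * x * c (inv_into {0..} f x)"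
    using assms by (intro mult_left_mono) auto
  also have "\<dots> = a * inv_into {0..} f x"
    using inverse_quotient_fixpoint[of x] assms by simp
  finally show ?thesis
    using inverse_quotient_fixpoint[of "a * x"] assms by simp
qed

end

section \<open>Quantitative strong law under weak dependence\<close>

theorem theorem2:
  fixes M :: "'a measure"
    and A :: "nat \<Rightarrow> 'a set"
    and \<psi> c f :: "real \<Rightarrow> real"
    and b :: "nat \<Rightarrow> real"
  assumes "prob_space M"
    and "\<And>n. n \<ge> 1 \<Longrightarrow> A n \<in> sets M"
    and "filterlim (event_mean M A) at_top sequentially"
    and "mono_on {0..} \<psi>"
    and "\<And>x. x \<ge> 0 \<Longrightarrow> \<psi> x > 0"
    and "summable (\<lambda>n. 1 / (real (Suc n) * \<psi> (real (Suc n))))"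
    and "\<And>x. x \<ge> 0 \<Longrightarrow> c x > 0"
    and "antimono_on {0..} c"
    and "continuous_on {0..} c"
    and "(c \<longlongrightarrow> 0) at_top"
    and "\<And>x. x \<ge> 0 \<Longrightarrow> f x = x / c x"
    and "strict_mono_on {0..} f"
    and "summable (\<lambda>n. b (Suc n))"
  shows
    "((\<forall>i j. 1 \<le> i \<and> i < j \<longrightarrow>
         measure M (A i \<inter> A j)
           \<le> (1 + c (real (j - i))) * measure M (A i) * measure M (A j) + b (j - i) * measure M (A i))
       \<longrightarrow> as_eq_little_o M (event_count A) (event_mean M A)
             (\<lambda>n. error_rate (\<lambda>x. x * inv_into {0..} f x) \<psi> (event_mean M A n)))
     \<and>
     ((\<forall>i j. 1 \<le> i \<and> i < j \<longrightarrow>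
         measure M (A i \<inter> A j)
           \<le> measure M (A i) * measure M (A j) + b (j - i) * measure M (A i))
       \<longrightarrow> as_eq_little_o M (event_count A) (event_mean M A)
             (\<lambda>n. error_rate (\<lambda>x. x) \<psi> (event_mean M A n)))"
proof -
  interpret prob_space M by fact
  obtain B where B: "0 \<le> B" "\<And>i n. (\<Sum>j\<in>{i<..n}. b (j - i)) \<le> B"
    using partial_sums_bounded_above[OF assms(13)] by metis
  note core = as_eq_little_o_of_variance_growth[OF assms(2-6)]
  show ?thesis
  proof (intro conjI impI)
    assume dep: "\<forall>i j. 1 \<le> i \<and> i < j \<longrightarrow> prob (A i \<inter> A j)
      \<le> (1 + c (real (j - i))) * prob (A i) * prob (A j) + b (j - i) * prob (A i)"
    define F where "F = inv_into {0..} f"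
    \<comment> \<open>The correlation terms give the second summand. The first absorbs the part of the variance that is
      linear in \<open>y\<close>, since \<open>F 1 \<le> F y\<close>.\<close>
    define K where "K = (1 + 2 * B) / F 1 + 2 * (c 0 + 1)"
    note inv = assms(7,8,9,11,12)
    have F_pos: "0 < F x" if "1 \<le> x" for x
      unfolding F_def by (rule inverse_quotient_pos[OF inv]) (use that in auto)
    have F_mono: "F x \<le> F y" if "1 \<le> x" "x \<le> y" for x y
      unfolding F_def by (rule inverse_quotient_mono[OF inv]) (use that in auto)
    have F_scale: "F (a * x) \<le> a * F x" if "1 \<le> a" "1 \<le> x" for a x
      unfolding F_def by (rule inverse_quotient_scale[OF inv]) (use that in auto)
    have F_fix: "F x = x * c (F x)" if "1 \<le> x" for x
      unfolding F_def by (rule inverse_quotient_fixpoint[OF inv]) (use that in auto)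
    have "as_eq_little_o M (event_count A) (event_mean M A)
        (\<lambda>n. error_rate (\<lambda>x. x * F x) \<psi> (event_mean M A n))"
    proof (rule core)
      show "0 \<le> K" using B(1) F_pos[of 1] assms(7)[of 0] by (simp add: K_def)
      fix m n :: nat and y :: real
      assume mn: "m \<le> n" and y: "1 \<le> y" "event_mean M A n - event_mean M A m \<le> y"
      define W where "W = B + (c 0 + 1) * F y"
      have W0: "0 \<le> W" using B(1) F_pos[OF y(1)] assms(7)[of 0] by (simp add: W_def)
      have "(\<integral>\<omega>. ((event_count A n \<omega> - event_mean M A n) - (event_count A m \<omega> - event_mean M A m))\<^sup>2 \<partial>M)
          \<le> (1 + 2 * W) * (event_mean M A n - event_mean M A m)"
      proof (rule variance_event_count_le[OF assms(2) mn])
        fix i assume i: "m < i" "i \<le> n"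
        have "(\<Sum>j\<in>{i<..n}. prob (A i \<inter> A j) - prob (A i) * prob (A j))
            \<le> (\<Sum>j\<in>{i<..n}. prob (A i) * (c (real (j - i)) * prob (A j) + b (j - i)))"
        proof (rule sum_mono)
          fix j assume "j \<in> {i<..n}"
          with dep i have "prob (A i \<inter> A j)
              \<le> (1 + c (real (j - i))) * prob (A i) * prob (A j) + b (j - i) * prob (A i)" by auto
          then show "prob (A i \<inter> A j) - prob (A i) * prob (A j)
              \<le> prob (A i) * (c (real (j - i)) * prob (A j) + b (j - i))"
            by (simp add: algebra_simps)
        qed
        also have "\<dots> = prob (A i) *
            ((\<Sum>j\<in>{i<..n}. c (real (j - i)) * prob (A j)) + (\<Sum>j\<in>{i<..n}. b (j - i)))"
          by (simp only: sum_distrib_left sum.distrib distrib_left)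
        also have "\<dots> \<le> prob (A i) * ((c 0 * F y + F y) + B)"
        proof (intro mult_left_mono add_mono B)
          have "(\<Sum>j\<in>{i<..n}. c (real (j - i)) * prob (A j))
              \<le> c 0 * F y + c (F y) * (\<Sum>j\<in>{i<..n}. prob (A j))"
            using F_pos[OF y(1)] assms(7) by (intro decaying_weights_sum_le assms(8)) (auto intro: less_imp_le)
          also have "\<dots> \<le> c 0 * F y + c (F y) * y"
          proof (intro add_left_mono mult_left_mono)
            have "(\<Sum>j\<in>{i<..n}. prob (A j)) \<le> (\<Sum>j\<in>{m<..n}. prob (A j))"
              using i by (intro sum_mono2) auto
            then show "(\<Sum>j\<in>{i<..n}. prob (A j)) \<le> y"
              using y(2) by (simp add: event_mean_diff[OF mn])
          qed (use assms(7)[of "F y"] F_pos[OF y(1)] in simp)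
          \<comment> \<open>The choice of the cut \<open>F y\<close> pays off: the far terms contribute no more than \<open>F y\<close> either.\<close>
          also have "\<dots> = c 0 * F y + F y" using F_fix[OF y(1)] by (simp add: mult.commute)
          finally show "(\<Sum>j\<in>{i<..n}. c (real (j - i)) * prob (A j)) \<le> c 0 * F y + F y" .
        qed simp
        finally show "(\<Sum>j\<in>{i<..n}. prob (A i \<inter> A j) - prob (A i) * prob (A j)) \<le> W * prob (A i)"
          by (simp add: W_def algebra_simps)
      qed
      also have "\<dots> \<le> (1 + 2 * W) * y" using y W0 by (intro mult_left_mono) auto
      also have "\<dots> \<le> K * F y * y"
      proof (intro mult_right_mono)
        have "1 + 2 * B \<le> (1 + 2 * B) / F 1 * F y"
          using F_mono[of 1 y] y B(1) F_pos[of 1]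
          by (simp add: pos_le_divide_eq mult_left_mono)
        then show "1 + 2 * W \<le> K * F y" by (simp add: W_def K_def algebra_simps)
      qed (use y in simp)
      finally show "(\<integral>\<omega>. ((event_count A n \<omega> - event_mean M A n) - (event_count A m \<omega> - event_mean M A m))\<^sup>2 \<partial>M)
          \<le> K * y * F y" by (simp add: mult_ac)
    qed (auto intro: F_pos F_mono F_scale)
    then show "as_eq_little_o M (event_count A) (event_mean M A)
        (\<lambda>n. error_rate (\<lambda>x. x * inv_into {0..} f x) \<psi> (event_mean M A n))"
      by (simp add: F_def)
  next
    assume dep: "\<forall>i j. 1 \<le> i \<and> i < j \<longrightarrow> prob (A i \<inter> A j)
      \<le> prob (A i) * prob (A j) + b (j - i) * prob (A i)"
    have "as_eq_little_o M (event_count A) (event_mean M A)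
        (\<lambda>n. error_rate (\<lambda>x. x * 1) \<psi> (event_mean M A n))"
    proof (rule core[where K = "1 + 2 * B"])
      fix m n :: nat and y :: real
      assume mn: "m \<le> n" and y: "1 \<le> y" "event_mean M A n - event_mean M A m \<le> y"
      have "(\<integral>\<omega>. ((event_count A n \<omega> - event_mean M A n) - (event_count A m \<omega> - event_mean M A m))\<^sup>2 \<partial>M)
          \<le> (1 + 2 * B) * (event_mean M A n - event_mean M A m)"
      proof (rule variance_event_count_le[OF assms(2) mn])
        fix i assume i: "m < i" "i \<le> n"
        have "(\<Sum>j\<in>{i<..n}. prob (A i \<inter> A j) - prob (A i) * prob (A j))
            \<le> (\<Sum>j\<in>{i<..n}. b (j - i) * prob (A i))"
        proof (rule sum_mono)
          fix j assume "j \<in> {i<..n}"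
          with dep i have "prob (A i \<inter> A j) \<le> prob (A i) * prob (A j) + b (j - i) * prob (A i)" by auto
          then show "prob (A i \<inter> A j) - prob (A i) * prob (A j) \<le> b (j - i) * prob (A i)" by simp
        qed
        also have "\<dots> \<le> B * prob (A i)"
          using B(2) by (simp add: mult_right_mono flip: sum_distrib_right)
        finally show "(\<Sum>j\<in>{i<..n}. prob (A i \<inter> A j) - prob (A i) * prob (A j)) \<le> B * prob (A i)" .
      qed
      also have "\<dots> \<le> (1 + 2 * B) * y" using y B(1) by (intro mult_left_mono) auto
      finally show "(\<integral>\<omega>. ((event_count A n \<omega> - event_mean M A n) - (event_count A m \<omega> - event_mean M A m))\<^sup>2 \<partial>M)
          \<le> (1 + 2 * B) * y * 1" by simp
    qed (use B(1) in auto)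
    then show "as_eq_little_o M (event_count A) (event_mean M A)
        (\<lambda>n. error_rate (\<lambda>x. x) \<psi> (event_mean M A n))" by simp
  qed
qed

end
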